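(* Let $(X,\mathcal{B})$ be a ball space and let $f:X\to X$ be a function which is ultimately contracting on orbits, witnessed by the function $X\ni x\mapsto B_x\in\mathcal{B}$. Assume that for all $x\in X$, if $y\in B_x$, then $B_y\subseteq B_x$. If $(X,\mathcal{B})$ is an $\mathbf{S}_1$ ball space, then for every $x\in X$, $f$ has a fixed point in $B_x$.
   Context: A ball space $(X,\mathcal{B})$ consists of a nonempty set $X$ and a nonempty family $\mathcal{B}$ of nonempty subsets of $X$, called balls. A nest of balls is a nonempty subset of $\mathcal{B}$ which is totally ordered by inclusion. $(X,\mathcal{B})$ is an $\mathbf{S}_1$ ball space if every nest of balls has nonempty intersection. We write $fx$ for $f(x)$, and $f^i$ is the $i$-th iterate of $f$ ($f^0x=x$, $f^{i+1}x=f(f^ix)$). The function $f$ is ultimately contracting on orbits if there is a function $X\ni x\mapsto B_x\in\mathcal{B}$ such that for all $x\in X$: (NB) $x\in B_x$; (CO) $B_{fx}\subseteq B_x$, and if $x\neq fx$, then $B_{f^ix}\subsetneq B_x$ for some $i\geq 1$. *)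

theory Defs
  imports Main "HOL-Library.FuncSet"
begin

definition ball_space :: "'a set \<Rightarrow> 'a set set \<Rightarrow> bool" where
  "ball_space X \<B> \<longleftrightarrow>
     X \<noteq> {} \<and> \<B> \<noteq> {} \<and> (\<forall>U\<in>\<B>. U \<noteq> {} \<and> U \<subseteq> X)"

definition nest_of_balls :: "'a set set \<Rightarrow> 'a set set \<Rightarrow> bool" where
  "nest_of_balls \<B> \<N> \<longleftrightarrow> \<N> \<noteq> {} \<and> subset.chain \<B> \<N>"

definition S1_ball_space :: "'a set \<Rightarrow> 'a set set \<Rightarrow> bool" where
  "S1_ball_space X \<B> \<longleftrightarrow>
     ball_space X \<B> \<and> (\<forall>\<N>. nest_of_balls \<B> \<N> \<longrightarrow> \<Inter>\<N> \<noteq> {})"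

text \<open>
  The second and third conjuncts of the following definition are the conditions (NB) and (CO).
  The values of \<open>f\<close> and \<open>B\<close> outside \<open>X\<close> are irrelevant.
\<close>

definition contracting_witness ::
    "'a set \<Rightarrow> 'a set set \<Rightarrow> ('a \<Rightarrow> 'a) \<Rightarrow> ('a \<Rightarrow> 'a set) \<Rightarrow> bool" where
  "contracting_witness X \<B> f B \<longleftrightarrow>
     B \<in> X \<rightarrow> \<B> \<and>
     (\<forall>x\<in>X. x \<in> B x) \<and>
     (\<forall>x\<in>X. B (f x) \<subseteq> B x \<and> (x \<noteq> f x \<longrightarrow> (\<exists>i\<ge>1. B ((f ^^ i) x) \<subset> B x)))"

definition ultimately_contracting_on_orbits ::
    "'a set \<Rightarrow> 'a set set \<Rightarrow> ('a \<Rightarrow> 'a) \<Rightarrow> bool" where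
  "ultimately_contracting_on_orbits X \<B> f \<longleftrightarrow> (\<exists>B. contracting_witness X \<B> f B)"

end

theory Submission
  imports Defs
begin

text \<open>
  The balls \<open>B y\<close> with \<open>y \<in> B x\<close> contain a minimal one, by the Hausdorff maximality principle: a
  maximal chain of such balls is a nest, so it has a common point \<open>z\<close>, and because every ball \<open>B y\<close>
  contains the balls of all its points, \<open>B z\<close> lies below the whole chain. By maximality no point of
  \<open>B z\<close> has a strictly smaller ball. If \<open>f z\<close> were different from \<open>z\<close>, then some iterate of \<open>z\<close>
  would have a strictly smaller ball, and it lies in \<open>B z\<close> because it lies in its own ball. So \<open>z\<close>
  is a fixed point.
\<close>

text \<open>
  Intersections of nests are only nonempty and need not contain a ball by themselves. The hypothesis
  \<open>nested\<close> bridges this gap: a point common to all balls of a chain has its own ball inside each of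
  them, so chains have lower bounds and a Zorn argument applies.
\<close>

lemma S1_obtains_minimal_ball:
  assumes S1: "S1_ball_space X \<B>"
    and B_ball: "B \<in> X \<rightarrow> \<B>"
    and centre: "\<And>y. y \<in> X \<Longrightarrow> y \<in> B y"
    and nested: "\<And>y w. y \<in> X \<Longrightarrow> w \<in> B y \<Longrightarrow> B w \<subseteq> B y"
    and x: "x \<in> X"
  obtains z where "z \<in> B x" and "\<And>w. w \<in> B z \<Longrightarrow> \<not> B w \<subset> B z"
proof -
  let ?A = "B ` B x"
  have "B x \<subseteq> X"
    using S1 B_ball x by (auto simp: S1_ball_space_def ball_space_def)
  hence A_balls: "?A \<subseteq> \<B>"
    using B_ball by auto
  obtain M where max: "subset.maxchain ?A M"
    using subset.Hausdorff by blast
  hence chain: "subset.chain ?A M"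
    by (rule subset.maxchain_imp_chain)
  have M_A: "M \<subseteq> ?A"
    using chain by (simp add: subset_chain_def)
  \<comment> \<open>A ball below every member of the maximal chain can be adjoined to it, hence is already in it.\<close>
  have extension: "C \<in> M" if "C \<in> ?A" and "\<And>D. D \<in> M \<Longrightarrow> C \<subseteq> D" for C
  proof -
    have "subset.chain ?A (insert C M)"
      using chain that by (auto simp: subset_chain_def)
    thus ?thesis
      using max by (auto simp: subset.maxchain_def)
  qed
  have "M \<noteq> {}"
    using extension[of "B x"] centre[OF x] by blast
  moreover have "subset.chain \<B> M"
    using chain A_balls by (auto simp: subset_chain_def)
  ultimately have "\<Inter>M \<noteq> {}"
    using S1 by (simp add: S1_ball_space_def nest_of_balls_def)
  then obtain z where z: "\<And>D. D \<in> M \<Longrightarrow> z \<in> D"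
    by blast
  have Bz_least: "B z \<subseteq> D" if "D \<in> M" for D
    using that M_A z[OF that] nested \<open>B x \<subseteq> X\<close> by blast
  obtain D where "D \<in> M"
    using \<open>M \<noteq> {}\<close> by blast
  hence zx: "z \<in> B x"
    using M_A z nested[OF x] by blast
  show thesis
  proof (rule that[OF zx], rule notI)
    fix w assume w: "w \<in> B z" and smaller: "B w \<subset> B z"
    have "w \<in> B x"
      using w nested[OF x zx] by blast
    moreover have "B w \<subseteq> D" if "D \<in> M" for D
      using smaller Bz_least[OF that] by blast
    ultimately have "B w \<in> M"
      by (intro extension) auto
    hence "B z \<subseteq> B w"
      by (rule Bz_least)
    thus False
      using smaller by blast
  qed
qed

theorem theorem2p8:
  fixes X :: "'a set" and \<B> :: "'a set set"
    and f :: "'a \<Rightarrow> 'a" and B :: "'a \<Rightarrow> 'a set"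
  assumes "ball_space X \<B>"
    and "f \<in> X \<rightarrow> X"
    and "contracting_witness X \<B> f B"
    and "\<forall>x\<in>X. \<forall>y. y \<in> B x \<longrightarrow> B y \<subseteq> B x"
    and "S1_ball_space X \<B>"
  shows "\<forall>x\<in>X. \<exists>z\<in>B x. f z = z"
proof
  fix x assume x: "x \<in> X"
  have B_ball: "B \<in> X \<rightarrow> \<B>" and centre: "\<And>y. y \<in> X \<Longrightarrow> y \<in> B y"
    and contracting: "\<And>y. y \<in> X \<Longrightarrow> y \<noteq> f y \<Longrightarrow> \<exists>i\<ge>1. B ((f ^^ i) y) \<subset> B y"
    using assms(3) by (auto simp: contracting_witness_def)
  obtain z where zx: "z \<in> B x" and minimal: "\<And>w. w \<in> B z \<Longrightarrow> \<not> B w \<subset> B z"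
    using S1_obtains_minimal_ball[OF assms(5) B_ball centre _ x] assms(4) by blast
  have z: "z \<in> X"
    using assms(1) B_ball x zx by (auto simp: ball_space_def)
  have "f z = z"
  proof (rule ccontr)
    assume "f z \<noteq> z"
    then obtain i where i: "B ((f ^^ i) z) \<subset> B z"
      using contracting[OF z] by metis
    have "(f ^^ i) z \<in> X"
      using z assms(2) by (induction i) auto
    hence "(f ^^ i) z \<in> B z"
      using centre i by blast
    thus False
      using minimal i by blast
  qed
  thus "\<exists>z\<in>B x. f z = z"
    using zx by blast
qed

end
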